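(* Write points of $\mathbb R^6$ as $(p,z)\in\mathbb R^2\times\mathbb R^4$. Define $q=(q_1,q_2)\colon\mathbb R^2\to\mathbb R^2$ by $q(p)=2p$ if $|p|\leq1/2$ and $q(p)=p/|p|$ if $|p|>1/2$. Set $a_1=2+q_1$, $a_2=2-q_1$, $a_3=2+q_2$, $a_4=2-q_2$, and $f(p,z):=\sum_{i=1}^4a_i(p)|z_i|$ on $\mathbb R^6$. Then every point $x^*=(p^*,0)$ with $|p^*|>1/2$ satisfies the active geometry assumption (defined in the context) for $f$ with active manifold $A=\mathbb R^2\times\{0\}$.
   Context: $\partial f$ is the Clarke subdifferential. $\widehat\partial f(x)$ is the Fréchet (regular) subdifferential: $v\in\widehat\partial f(x)$ iff $f(z)\geq f(x)+\langle v,z-x\rangle+o(|z-x|)$ as $z\to x$. Active geometry assumption for $f\colon\mathbb R^n\to\mathbb R$ at $x^*$ with active manifold $A$: $f$ is locally Lipschitz, $0\in\widehat\partial f(x^* )$, $A\subset\mathbb R^n$ is a definable $C^3$ (embedded) manifold containing $x^*$, and there exist an open neighborhood $U_0$ of $x^*$ and constants $\sigma_{\mathrm A},C_{\mathrm V}>0$ such that: (i) (activity) $f|_A$ is $C^2$ on $A\cap U_0$, and $|v|\geq\sigma_{\mathrm A}$ for all $z\in U_0\setminus A$, $v\in\partial f(z)$; (ii) (Verdier compatibility) for every $z\in U_0$, $y\in A\cap U_0$, and $v\in\partial f(z)$, $|P_{T_A(y)}v-\nabla_Af(y)|\leq C_{\mathrm V}|z-y|$. Here $T_A(y)$ is the tangent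 space, $P_{T_A(y)}$ the orthogonal projection onto it, and $\nabla_Af$ the Riemannian gradient of $f|_A$ on $A$. "Definable" means definable in a fixed polynomially bounded o-minimal structure expanding the real field; every semialgebraic set is definable in any such structure. *)

theory Defs
  imports "HOL-Analysis.Analysis" "HOL-Library.Landau_Symbols"
begin

section \<open>Polynomially bounded o-minimal expansions of the real field\<close>

text \<open>
  A structure is a family \<open>S n\<close> of sets of real lists of length \<open>n\<close>; the sets in \<open>S n\<close> are the
  definable subsets of n-space. Definability is with real parameters: every
  singleton is a (degenerate) interval, hence belongs to \<open>S 1\<close>.
\<close>

locale ominimal_field_structure =
  fixes S :: "nat \<Rightarrow> real list set set"
  assumes definable_length: "A \<in> S n \<Longrightarrow> xs \<in> A \<Longrightarrow> length xs = n"
    and definable_empty: "{} \<in> S n"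
    and definable_compl: "A \<in> S n \<Longrightarrow> {xs. length xs = n} - A \<in> S n"
    and definable_union: "A \<in> S n \<Longrightarrow> B \<in> S n \<Longrightarrow> A \<union> B \<in> S n"
    and definable_prepend: "A \<in> S n \<Longrightarrow> {x # xs | x xs. xs \<in> A} \<in> S (Suc n)"
    and definable_append: "A \<in> S n \<Longrightarrow> {xs @ [x] | x xs. xs \<in> A} \<in> S (Suc n)"
    and definable_diagonal: "n \<ge> 1 \<Longrightarrow> {xs. length xs = n \<and> hd xs = last xs} \<in> S n"
    and definable_projection: "A \<in> S (Suc n) \<Longrightarrow> butlast ` A \<in> S n"
    and definable_less: "{[x, y] | x y. x < y} \<in> S 2"
    and definable_add: "{[x, y, x + y] | x y. True} \<in> S 3"
    and definable_mult: "{[x, y, x * y] | x y. True} \<in> S 3"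
    and ominimal: "S 1 = {(\<lambda>x. [x]) ` (\<Union>F) | F. finite F \<and> (\<forall>I\<in>F. is_interval I)}"

locale poly_bounded_ominimal = ominimal_field_structure +
  assumes poly_bounded:
    "{[x, g x] | x. True} \<in> S 2 \<Longrightarrow> \<exists>N::nat. \<forall>\<^sub>F x in at_top. \<bar>g x\<bar> \<le> x ^ N"

text \<open>
  Subsets of a Euclidean space are read in coordinates. The order of the coordinates
  is immaterial, since structures are closed under permuting them.
\<close>

definition definable_in :: "(nat \<Rightarrow> real list set set) \<Rightarrow> 'a::euclidean_space set \<Rightarrow> bool" where
  "definable_in S A \<longleftrightarrow>
    (\<forall>bs. distinct bs \<and> set bs = Basis \<longrightarrow> (\<lambda>x. map (\<lambda>b. x \<bullet> b) bs) ` A \<in> S DIM('a))"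


section \<open>Subdifferentials\<close>

definition locally_lipschitz :: "('a::metric_space \<Rightarrow> 'b::metric_space) \<Rightarrow> bool" where
  "locally_lipschitz f \<longleftrightarrow> (\<forall>x. \<exists>e>0. \<exists>L. L-lipschitz_on (ball x e) f)"

definition frechet_subdiff :: "('a::euclidean_space \<Rightarrow> real) \<Rightarrow> 'a \<Rightarrow> 'a set" where
  "frechet_subdiff f x =
    {v. \<exists>r \<in> o[at x](\<lambda>z. norm (z - x)). \<forall>\<^sub>F z in at x. f z \<ge> f x + v \<bullet> (z - x) + r z}"

text \<open>Clarke's generalized directional derivative: limsup over \<open>y \<rightarrow> x\<close>, \<open>t \<down> 0\<close>.\<close>

definition clarke_dderiv :: "('a::euclidean_space \<Rightarrow> real) \<Rightarrow> 'a \<Rightarrow> 'a \<Rightarrow> ereal" where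
  "clarke_dderiv f x d =
    Limsup (nhds x \<times>\<^sub>F at_right 0) (\<lambda>(y, t). ereal ((f (y + t *\<^sub>R d) - f y) / t))"

definition clarke_subdiff :: "('a::euclidean_space \<Rightarrow> real) \<Rightarrow> 'a \<Rightarrow> 'a set" where
  "clarke_subdiff f x = {v. \<forall>d. ereal (v \<bullet> d) \<le> clarke_dderiv f x d}"


section \<open>Embedded manifolds\<close>

text \<open>Maps of class \<open>C\<^sup>k\<close>; only meant for open \<open>U\<close>.\<close>

primrec Ck_on :: "nat \<Rightarrow> 'a::euclidean_space set \<Rightarrow> ('a \<Rightarrow> 'b::real_normed_vector) \<Rightarrow> bool" where
  "Ck_on 0 U f \<longleftrightarrow> continuous_on U f"
| "Ck_on (Suc k) U f \<longleftrightarrow>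
    (\<forall>x\<in>U. f differentiable at x) \<and> (\<forall>v. Ck_on k U (\<lambda>x. frechet_derivative f (at x) v))"

definition embedded_manifold :: "nat \<Rightarrow> 'a::euclidean_space set \<Rightarrow> bool" where
  "embedded_manifold k A \<longleftrightarrow>
    (\<exists>d. \<forall>x\<in>A. \<exists>U V \<Phi> \<Psi> L. open U \<and> x \<in> U \<and> open V \<and>
        homeomorphism U V \<Phi> \<Psi> \<and> Ck_on k U \<Phi> \<and> Ck_on k V (\<Psi> :: 'a \<Rightarrow> 'a) \<and>
        subspace L \<and> dim L = d \<and> \<Phi> ` (A \<inter> U) = L \<inter> V)"

definition C1_curve_in :: "'a::euclidean_space set \<Rightarrow> 'a \<Rightarrow> 'a \<Rightarrow> (real \<Rightarrow> 'a) \<Rightarrow> bool" where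
  "C1_curve_in A y v c \<longleftrightarrow>
    (\<exists>e>0. c C1_differentiable_on {-e<..<e} \<and> c ` {-e<..<e} \<subseteq> A) \<and>
    c 0 = y \<and> (c has_vector_derivative v) (at 0)"

definition tangent_space :: "'a::euclidean_space set \<Rightarrow> 'a \<Rightarrow> 'a set" where
  "tangent_space A y = {v. \<exists>c. C1_curve_in A y v c}"

definition orth_proj :: "'a::euclidean_space set \<Rightarrow> 'a \<Rightarrow> 'a" where
  "orth_proj T v = (THE w. w \<in> T \<and> (\<forall>u\<in>T. orthogonal (v - w) u))"

definition Ck_restriction_on :: "nat \<Rightarrow> 'a::euclidean_space set \<Rightarrow> 'a set \<Rightarrow> ('a \<Rightarrow> real) \<Rightarrow> bool" where
  "Ck_restriction_on k A U f \<longleftrightarrow>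
    (\<forall>y\<in>A \<inter> U. \<exists>W F. open W \<and> y \<in> W \<and> Ck_on k W F \<and> (\<forall>x\<in>A \<inter> W. F x = f x))"

text \<open>
  Riemannian gradient for the metric induced by the ambient inner product: the tangent vector
  representing the differential of \<open>f\<close> restricted to \<open>A\<close>, computed along curves in \<open>A\<close>.
\<close>

definition riemannian_grad :: "'a::euclidean_space set \<Rightarrow> ('a \<Rightarrow> real) \<Rightarrow> 'a \<Rightarrow> 'a" where
  "riemannian_grad A f y =
    (THE g. g \<in> tangent_space A y \<and>
      (\<forall>v c. C1_curve_in A y v c \<longrightarrow> ((\<lambda>t. f (c t)) has_real_derivative g \<bullet> v) (at 0)))"


section \<open>Active geometry\<close>

definition active_geometry ::
  "(nat \<Rightarrow> real list set set) \<Rightarrow> ('a::euclidean_space \<Rightarrow> real) \<Rightarrow> 'a set \<Rightarrow> 'a \<Rightarrow> bool" where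
  "active_geometry S f A xstar \<longleftrightarrow>
    locally_lipschitz f \<and> 0 \<in> frechet_subdiff f xstar \<and>
    definable_in S A \<and> embedded_manifold 3 A \<and> xstar \<in> A \<and>
    (\<exists>U0 \<sigma> C. open U0 \<and> xstar \<in> U0 \<and> \<sigma> > 0 \<and> C > 0 \<and>
      Ck_restriction_on 2 A U0 f \<and>
      (\<forall>z\<in>U0 - A. \<forall>v\<in>clarke_subdiff f z. norm v \<ge> \<sigma>) \<and>
      (\<forall>z\<in>U0. \<forall>y\<in>A \<inter> U0. \<forall>v\<in>clarke_subdiff f z.
        norm (orth_proj (tangent_space A y) v - riemannian_grad A f y) \<le> C * norm (z - y)))"


section \<open>The example\<close>

definition q_ex :: "real^2 \<Rightarrow> real^2" where
  "q_ex p = (if norm p \<le> 1/2 then 2 *\<^sub>R p else p /\<^sub>R norm p)"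

definition a_ex :: "4 \<Rightarrow> real^2 \<Rightarrow> real" where
  "a_ex i p = (if i = 1 then 2 + q_ex p $ 1 else if i = 2 then 2 - q_ex p $ 1
            else if i = 3 then 2 + q_ex p $ 2 else 2 - q_ex p $ 2)"

definition f_ex :: "(real^2) \<times> (real^4) \<Rightarrow> real" where
  "f_ex = (\<lambda>(p, z). \<Sum>i\<in>UNIV. a_ex i p * \<bar>z $ i\<bar>)"

end

theory Submission
  imports Defs
begin

text \<open>
  The map \<open>q\<close> is twice the nearest-point projection onto the ball of radius \<open>1/2\<close>, so it is
  2-Lipschitz with values in the unit ball; hence the \<open>a\<^sub>i\<close> are 2-Lipschitz with values in \<open>[1, 3]\<close>.
  Off \<open>A\<close> some \<open>z\<^sub>i\<close> is nonzero, and moving \<open>z\<^sub>i\<close> towards \<open>0\<close> decreases \<open>f\<close> at rate \<open>a\<^sub>i \<ge> 1\<close>, so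
  Clarke subgradients have norm at least 1. As \<open>f\<close> vanishes on \<open>A\<close>, its Riemannian gradient is \<open>0\<close>,
  and the component of a Clarke subgradient along \<open>A\<close> is bounded by the Lipschitz constant of
  \<open>p \<mapsto> f(p, z)\<close>, which is at most \<open>2 \<Sum>\<^sub>i |z\<^sub>i| \<le> 8 |z|\<close>.
\<close>

section \<open>Definability of coordinate subspaces\<close>

context ominimal_field_structure
begin

lemma definable_UNIV: "{xs. length xs = n} \<in> S n"
  using definable_compl[OF definable_empty] by simp

lemma definable_inter:
  assumes "A \<in> S n" "B \<in> S n"
  shows "A \<inter> B \<in> S n"
proof -
  let ?U = "{xs :: real list. length xs = n}"
  have "A \<inter> B = ?U - ((?U - A) \<union> (?U - B))"
    using definable_length[OF assms(1)] definable_length[OF assms(2)] by auto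
  then show ?thesis
    using assms definable_compl definable_union by simp
qed

text \<open>Induction on the dimension: a positive index is lowered by stripping the first
  coordinate with \<open>definable_prepend\<close>, index 0 is kept by stripping the last one with
  \<open>definable_append\<close>. In dimension 1 the set is the degenerate interval
  \<open>{0}\<close>, definable by \<open>ominimal\<close>.\<close>

lemma definable_nth_eq_zero:
  assumes "i < n"
  shows "{xs. length xs = n \<and> xs ! i = 0} \<in> S n"
  using assms
proof (induction n arbitrary: i)
  case (Suc n)
  show ?case
  proof (cases i)
    case 0
    show ?thesis
    proof (cases n)
      case n0: 0
      have "(\<lambda>x. [x]) ` (\<Union>{{0}}) \<in> S 1"
        unfolding ominimal by (intro CollectI exI[of _ "{{0::real}}"]) (auto simp: is_interval_1)
      moreover have "(\<lambda>x. [x]) ` (\<Union>{{0}}) = {xs :: real list. length xs = 1 \<and> xs ! 0 = 0}"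
        by (auto simp: length_Suc_conv)
      ultimately show ?thesis using 0 n0 by simp
    next
      case (Suc m)
      have "{xs @ [x] | x xs. xs \<in> {xs :: real list. length xs = n \<and> xs ! 0 = 0}}
          = {xs. length xs = Suc n \<and> xs ! 0 = 0}"
      proof (intro set_eqI iffI)
        fix xs :: "real list"
        assume "xs \<in> {xs. length xs = Suc n \<and> xs ! 0 = 0}"
        then have "xs = butlast xs @ [last xs]" "length (butlast xs) = n" "butlast xs ! 0 = 0"
          using Suc by (auto simp: nth_butlast simp flip: length_greater_0_conv)
        then show "xs \<in> {xs @ [x] | x xs. xs \<in> {xs :: real list. length xs = n \<and> xs ! 0 = 0}}"
          by blast
      qed (use Suc in \<open>auto simp: nth_append\<close>)
      then show ?thesis
        using definable_append[OF Suc.IH[of 0]] Suc 0 by simp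
    qed
  next
    case (Suc j)
    have "{x # xs | x xs. xs \<in> {xs :: real list. length xs = n \<and> xs ! j = 0}}
        = {xs. length xs = Suc n \<and> xs ! i = 0}"
      using Suc by (auto simp: length_Suc_conv)
    then show ?thesis
      using definable_prepend[OF Suc.IH[of j]] Suc Suc.prems by simp
  qed
qed simp

lemma definable_nths_eq_zero:
  assumes "finite I" "I \<subseteq> {..<n}"
  shows "{xs. length xs = n \<and> (\<forall>i\<in>I. xs ! i = 0)} \<in> S n"
  using assms
proof (induction I rule: finite_induct)
  case empty
  then show ?case using definable_UNIV by simp
next
  case (insert i I)
  have "{xs. length xs = n \<and> (\<forall>i\<in>insert i I. xs ! i = 0)}
      = {xs :: real list. length xs = n \<and> xs ! i = 0}
        \<inter> {xs. length xs = n \<and> (\<forall>i\<in>I. xs ! i = 0)}"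
    by auto
  then show ?case
    using insert definable_nth_eq_zero definable_inter by simp
qed

text \<open>Whatever the ordering \<open>bs\<close> of the basis, the members of \<open>B\<close>
  occupy some index set, and the coordinate image consists of the lists vanishing on it.\<close>

lemma definable_in_coordinate_subspace:
  fixes B :: "'a::euclidean_space set"
  shows "definable_in S {x. \<forall>b\<in>B \<inter> Basis. x \<bullet> b = 0}"
  unfolding definable_in_def
proof (intro allI impI)
  fix bs :: "'a list"
  assume bs: "distinct bs \<and> set bs = Basis"
  then have len: "length bs = DIM('a)"
    by (metis distinct_card)
  let ?I = "{i. i < DIM('a) \<and> bs ! i \<in> B}"
  have "(\<lambda>x. map (\<lambda>b. x \<bullet> b) bs) ` {x. \<forall>b\<in>B \<inter> Basis. x \<bullet> b = 0}
      = {xs. length xs = DIM('a) \<and> (\<forall>i\<in>?I. xs ! i = 0)}" (is "?l = ?r")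
  proof (intro set_eqI iffI)
    fix xs assume "xs \<in> ?l"
    then obtain x where x: "xs = map (\<lambda>b. x \<bullet> b) bs" "\<forall>b\<in>B \<inter> Basis. x \<bullet> b = 0"
      by blast
    have "xs ! i = 0" if "i \<in> ?I" for i
    proof -
      have "bs ! i \<in> B \<inter> Basis" using that bs len nth_mem[of i bs] by simp
      then show ?thesis using x that len by simp
    qed
    then show "xs \<in> ?r" using x len by simp
  next
    fix xs assume xs: "xs \<in> ?r"
    \<comment> \<open>The point whose coordinates along \<open>bs\<close> are \<open>xs\<close>;
      orthonormality of \<open>bs\<close> recovers them.\<close>
    let ?x = "\<Sum>i<DIM('a). xs ! i *\<^sub>R bs ! i"
    have x: "?x \<bullet> bs ! j = xs ! j" if "j < DIM('a)" for j
    proof -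
      have "bs ! i \<bullet> bs ! j = (if i = j then 1 else 0)" if "i < DIM('a)" for i
        using that \<open>j < DIM('a)\<close> bs len by (metis inner_Basis nth_eq_iff_index_eq nth_mem)
      then have "?x \<bullet> bs ! j = (\<Sum>i<DIM('a). if i = j then xs ! i else 0)"
        unfolding inner_sum_left by (intro sum.cong) auto
      then show ?thesis using that by simp
    qed
    have "?x \<bullet> b = 0" if "b \<in> B \<inter> Basis" for b
    proof -
      have "b \<in> set bs" using that bs by simp
      then obtain j where j: "j < DIM('a)" "b = bs ! j"
        unfolding in_set_conv_nth len by blast
      have "xs ! j = 0" using xs that j by blast
      then show ?thesis using x[OF j(1)] unfolding j(2) by (rule trans[rotated])
    qed
    moreover have "xs = map (\<lambda>b. ?x \<bullet> b) bs"
    proof (rule nth_equalityI)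
      fix i assume "i < length xs"
      then have i: "i < DIM('a)" using xs by simp
      then have "map (\<lambda>b. ?x \<bullet> b) bs ! i = ?x \<bullet> bs ! i" using len by (intro nth_map) simp
      then show "xs ! i = map (\<lambda>b. ?x \<bullet> b) bs ! i" using x[OF i] by (rule trans[THEN sym])
    qed (use xs len in simp)
    ultimately show "xs \<in> ?l" by blast
  qed
  moreover have "?r \<in> S DIM('a)"
    by (rule definable_nths_eq_zero) auto
  ultimately show "(\<lambda>x. map (\<lambda>b. x \<bullet> b) bs) ` {x. \<forall>b\<in>B \<inter> Basis. x \<bullet> b = 0} \<in> S DIM('a)"
    by simp
qed

end

text \<open>Brings the active manifold into coordinate-subspace form: the basis vectors in
  \<open>{0} \<times> UNIV\<close> are exactly those of the second factor.\<close>

lemma UNIV_times_zero_eq: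
  "UNIV \<times> {0} = {x :: 'a::euclidean_space \<times> 'b::euclidean_space. \<forall>b\<in>({0} \<times> UNIV) \<inter> Basis. x \<bullet> b = 0}"
proof (intro set_eqI iffI)
  fix x :: "'a \<times> 'b"
  assume x: "x \<in> {x. \<forall>b\<in>({0} \<times> UNIV) \<inter> Basis. x \<bullet> b = 0}"
  have "snd x \<bullet> b = 0" if "b \<in> Basis" for b
  proof -
    have "x \<bullet> (0, b) = 0" using x that by (auto simp: Basis_prod_def)
    then show ?thesis by (simp add: inner_prod_def)
  qed
  then have "snd x = 0" using euclidean_all_zero_iff by blast
  then show "x \<in> UNIV \<times> {0}" by (simp add: mem_Times_iff)
qed (auto simp: inner_prod_def)

section \<open>Linear subspaces as manifolds\<close>

lemma Ck_on_const: "Ck_on k U (\<lambda>x. c)"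
  by (induction k arbitrary: c) auto

lemma Ck_on_ident: "Ck_on k U (\<lambda>x. x)"
  by (cases k) (auto simp: Ck_on_const)

text \<open>The identity is a single global chart, with \<open>L\<close> itself as model
  subspace.\<close>

lemma embedded_manifold_subspace:
  fixes L :: "'a::euclidean_space set"
  assumes "subspace L"
  shows "embedded_manifold k L"
  unfolding embedded_manifold_def
proof (intro exI[of _ "dim L"] ballI)
  fix x assume "x \<in> L"
  show "\<exists>U V \<Phi> \<Psi> M. open U \<and> x \<in> U \<and> open V \<and>
        homeomorphism U V \<Phi> \<Psi> \<and> Ck_on k U \<Phi> \<and> Ck_on k V (\<Psi> :: 'a \<Rightarrow> 'a) \<and>
        subspace M \<and> dim M = dim L \<and> \<Phi> ` (L \<inter> U) = M \<inter> V"
    by (rule exI[of _ UNIV], rule exI[of _ UNIV], rule exI[of _ "\<lambda>x. x"],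
        rule exI[of _ "\<lambda>x. x"], rule exI[of _ L])
      (auto simp: assms Ck_on_ident homeomorphism_def)
qed

text \<open>A velocity is a limit of difference quotients lying in \<open>L\<close>, and
  \<open>L\<close> is closed; conversely each \<open>v\<close> in \<open>L\<close> is the velocity
  of a straight line in \<open>L\<close>.\<close>

lemma tangent_space_subspace:
  fixes L :: "'a::euclidean_space set"
  assumes L: "subspace L" and y: "y \<in> L"
  shows "tangent_space L y = L"
proof (intro set_eqI iffI)
  fix v assume "v \<in> tangent_space L y"
  then obtain c e where e: "e > 0" and cL: "c ` {-e<..<e} \<subseteq> L"
    and c: "c 0 = y" "(c has_vector_derivative v) (at 0)"
    unfolding tangent_space_def C1_curve_in_def by blast
  have lim: "((\<lambda>h. (c h - c 0) /\<^sub>R h) \<longlongrightarrow> v) (at 0)"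
  proof -
    have "((\<lambda>h. norm (c h - c 0 - h *\<^sub>R v) / norm h) \<longlongrightarrow> 0) (at 0)"
      using c(2) by (simp add: has_vector_derivative_def has_derivative_iff_norm)
    moreover have "norm (c h - c 0 - h *\<^sub>R v) / norm h = norm ((c h - c 0) /\<^sub>R h - v)"
      if "h \<noteq> 0" for h
    proof -
      have "(c h - c 0) /\<^sub>R h - v = (c h - c 0 - h *\<^sub>R v) /\<^sub>R h"
        using that by (simp add: scaleR_diff_right)
      then show ?thesis by (simp add: divide_inverse_commute)
    qed
    ultimately have "((\<lambda>h. norm ((c h - c 0) /\<^sub>R h - v)) \<longlongrightarrow> 0) (at 0)"
      by (elim Lim_transform_eventually) (simp add: eventually_at_filter)
    then show ?thesis by (rule LIM_zero_cancel[OF tendsto_norm_zero_cancel])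
  qed
  have "\<forall>\<^sub>F h in at 0. h \<in> {-e<..<e}"
    using e by (intro eventually_at_in_open') auto
  then have "\<forall>\<^sub>F h in at 0. (c h - c 0) /\<^sub>R h \<in> L"
  proof eventually_elim
    case (elim h)
    then have "c h \<in> L" using cL by blast
    then show ?case using L c(1) y by (simp add: subspace_diff subspace_scale)
  qed
  then show "v \<in> L"
    using Lim_in_closed_set[OF closed_subspace[OF L] _ _ lim] by simp
next
  fix v assume v: "v \<in> L"
  have "C1_curve_in L y v (\<lambda>t. y + t *\<^sub>R v)"
    unfolding C1_curve_in_def
    using L y v
    by (auto intro!: exI[of _ 1] derivative_eq_intros simp: subspace_add subspace_scale)
  then show "v \<in> tangent_space L y" unfolding tangent_space_def by blast
qed

text \<open>Two candidates differ by a vector of \<open>T\<close> that is orthogonal to both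
  residuals, hence to itself.\<close>

lemma orth_proj_eqI:
  fixes T :: "'a::euclidean_space set"
  assumes T: "subspace T" and w: "w \<in> T" "\<And>u. u \<in> T \<Longrightarrow> orthogonal (v - w) u"
  shows "orth_proj T v = w"
  unfolding orth_proj_def
proof (rule the_equality)
  fix w' assume w': "w' \<in> T \<and> (\<forall>u\<in>T. orthogonal (v - w') u)"
  then have "w - w' \<in> T" using T w(1) by (simp add: subspace_diff)
  then have "orthogonal (v - w') (w - w')" "orthogonal (v - w) (w - w')"
    using w' w by auto
  then have "(w - w') \<bullet> (w - w') = 0"
    by (simp add: orthogonal_def algebra_simps)
  then show "w' = w" by simp
qed (use w in auto)

text \<open>Along any curve in \<open>L\<close> the function is constantly 0. For uniqueness, a
  candidate \<open>g\<close> is tested on a curve with velocity \<open>g\<close>.\<close>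

lemma riemannian_grad_eq_zero:
  fixes L :: "'a::euclidean_space set"
  assumes L: "subspace L" and y: "y \<in> L" and f: "\<And>x. x \<in> L \<Longrightarrow> f x = 0"
  shows "riemannian_grad L f y = 0"
  unfolding riemannian_grad_def
proof (rule the_equality)
  have deriv: "((\<lambda>t. f (c t)) has_real_derivative 0) (at 0)" if c: "C1_curve_in L y v c" for v c
  proof -
    obtain e where e: "e > 0" "c ` {-e<..<e} \<subseteq> L"
      using c unfolding C1_curve_in_def by blast
    show ?thesis
      by (rule has_field_derivative_transform_within_open[of "\<lambda>t. 0" 0 0 "{-e<..<e}"])
        (use e f in \<open>auto simp: image_subset_iff\<close>)
  qed
  show "0 \<in> tangent_space L y \<and>
      (\<forall>v c. C1_curve_in L y v c \<longrightarrow> ((\<lambda>t. f (c t)) has_real_derivative 0 \<bullet> v) (at 0))"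
    using deriv by (simp add: tangent_space_subspace[OF L y] subspace_0[OF L])
  fix g assume g: "g \<in> tangent_space L y \<and>
      (\<forall>v c. C1_curve_in L y v c \<longrightarrow> ((\<lambda>t. f (c t)) has_real_derivative g \<bullet> v) (at 0))"
  then obtain c where "C1_curve_in L y g c" unfolding tangent_space_def by blast
  then have "g \<bullet> g = 0" using g deriv DERIV_unique by blast
  then show "g = 0" by simp
qed

section \<open>Clarke subgradients\<close>

text \<open>The bound may vary with the base point \<open>y\<close>; continuity of \<open>g\<close>
  at \<open>x\<close> turns its limsup into \<open>g x\<close>.\<close>

lemma clarke_dderiv_le:
  assumes "\<forall>\<^sub>F (y, t) in nhds x \<times>\<^sub>F at_right 0. (f (y + t *\<^sub>R d) - f y) / t \<le> g y"
    and "isCont g x"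
  shows "clarke_dderiv f x d \<le> ereal (g x)"
proof -
  let ?F = "nhds x \<times>\<^sub>F at_right (0::real)"
  have "filterlim (\<lambda>y. g y) (nhds (g x)) (nhds x)"
    using assms(2) by (simp add: isCont_def tendsto_at_iff_tendsto_nhds)
  then have "((\<lambda>(y, t). ereal (g y)) \<longlongrightarrow> ereal (g x)) ?F"
    unfolding case_prod_beta by (intro tendsto_ereal filterlim_compose[OF _ filterlim_fst])
  \<comment> \<open>On the trivial filter the limsup would not equal the limit.\<close>
  moreover have "?F \<noteq> bot" by (simp add: prod_filter_eq_bot)
  ultimately have "Limsup ?F (\<lambda>(y, t). ereal (g y)) = ereal (g x)"
    by (rule lim_imp_Limsup[rotated])
  moreover have "clarke_dderiv f x d \<le> Limsup ?F (\<lambda>(y, t). ereal (g y))"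
    unfolding clarke_dderiv_def
    by (rule Limsup_mono) (use assms(1) in \<open>auto elim!: eventually_mono\<close>)
  ultimately show ?thesis by simp
qed

lemma clarke_subdiff_inner_le:
  assumes "v \<in> clarke_subdiff f x"
    and "\<forall>\<^sub>F (y, t) in nhds x \<times>\<^sub>F at_right 0. (f (y + t *\<^sub>R d) - f y) / t \<le> g y"
    and "isCont g x"
  shows "v \<bullet> d \<le> g x"
proof -
  have "ereal (v \<bullet> d) \<le> clarke_dderiv f x d"
    using assms(1) by (simp add: clarke_subdiff_def)
  also have "\<dots> \<le> ereal (g x)" using assms(2,3) by (rule clarke_dderiv_le)
  finally show ?thesis by simp
qed

section \<open>The example\<close>

text \<open>Makes nonexpansiveness of projections onto closed convex sets available, so the
  Lipschitz bound for q needs no case split at the kink.\<close>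

lemma q_ex_eq_closest_point: "q_ex p = 2 *\<^sub>R closest_point (cball 0 (1/2)) p"
proof (cases "norm p \<le> 1/2")
  case True
  then show ?thesis by (simp add: q_ex_def closest_point_self)
next
  case False
  \<comment> \<open>The radial rescaling of \<open>p\<close> to norm 1/2; it attains the lower bound
    \<open>norm p - 1/2\<close> that the reverse triangle inequality gives on the ball.\<close>
  let ?x = "(1 / (2 * norm p)) *\<^sub>R p"
  have "p - ?x = (1 - 1 / (2 * norm p)) *\<^sub>R p" by (simp add: scaleR_diff_left)
  then have "dist p ?x = \<bar>1 - 1 / (2 * norm p)\<bar> * norm p" by (simp only: dist_norm norm_scaleR)
  also have "\<dots> = norm p - 1/2" using False by (auto simp: abs_if field_simps)
  finally have "dist p ?x = norm p - 1/2" .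
  moreover have "norm p - 1/2 \<le> dist p z" if "z \<in> cball 0 (1/2)" for z
    using that norm_triangle_ineq2[of p z] by (simp add: dist_norm)
  moreover have "?x \<in> cball 0 (1/2)" using False by auto
  ultimately have "?x = closest_point (cball 0 (1/2)) p"
    by (intro closest_point_unique) auto
  moreover have "q_ex p = 2 *\<^sub>R ?x" using False by (simp add: q_ex_def inverse_eq_divide)
  ultimately show ?thesis by simp
qed

lemma norm_q_ex_le: "norm (q_ex p) \<le> 1"
  using closest_point_in_set[of "cball 0 (1/2)" p]
  by (simp add: q_ex_eq_closest_point)

lemma q_ex_lipschitz: "norm (q_ex p - q_ex p') \<le> 2 * norm (p - p')"
proof -
  have "q_ex p - q_ex p'
      = 2 *\<^sub>R (closest_point (cball 0 (1/2)) p - closest_point (cball 0 (1/2)) p')"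
    by (simp add: q_ex_eq_closest_point scaleR_diff_right)
  then show ?thesis
    using closest_point_lipschitz[of "cball 0 (1/2)" p p'] by (simp add: dist_norm)
qed

lemma a_ex_bounds: "1 \<le> a_ex i p" "a_ex i p \<le> 3"
proof -
  have "\<bar>q_ex p $ j\<bar> \<le> 1" for j
    using component_le_norm_cart norm_q_ex_le order_trans by blast
  from this[of 1] this[of 2] show "1 \<le> a_ex i p" "a_ex i p \<le> 3"
    by (auto simp: a_ex_def abs_le_iff)
qed

lemma a_ex_lipschitz: "\<bar>a_ex i p - a_ex i p'\<bar> \<le> 2 * norm (p - p')"
proof -
  have "\<bar>q_ex p $ j - q_ex p' $ j\<bar> \<le> 2 * norm (p - p')" for j
    using component_le_norm_cart[of "q_ex p - q_ex p'" j] q_ex_lipschitz[of p p'] by simp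
  from this[of 1] this[of 2] show ?thesis
    by (auto simp: a_ex_def abs_minus_commute)
qed

section \<open>Lipschitz estimates for f\<close>

lemma f_ex_zero: "x \<in> UNIV \<times> {0} \<Longrightarrow> f_ex x = 0"
  by (auto simp: f_ex_def)

lemma f_ex_nonneg: "0 \<le> f_ex x"
  unfolding f_ex_def case_prod_beta
  by (intro sum_nonneg mult_nonneg_nonneg) (auto intro: order_trans[OF _ a_ex_bounds(1)])

text \<open>The sum of the absolute values is kept as a factor because it vanishes on the active
  manifold, which is what Verdier compatibility exploits.\<close>

lemma f_ex_lipschitz_fst:
  "\<bar>f_ex (p, z) - f_ex (p', z)\<bar> \<le> 2 * norm (p - p') * (\<Sum>i\<in>UNIV. \<bar>z $ i\<bar>)"
proof -
  have "\<bar>f_ex (p, z) - f_ex (p', z)\<bar> = \<bar>\<Sum>i\<in>UNIV. (a_ex i p - a_ex i p') * \<bar>z $ i\<bar>\<bar>"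
    by (simp add: f_ex_def sum_subtractf left_diff_distrib)
  also have "\<dots> \<le> (\<Sum>i\<in>UNIV. 2 * norm (p - p') * \<bar>z $ i\<bar>)"
    by (rule order_trans[OF sum_abs])
      (auto simp: abs_mult intro!: sum_mono mult_right_mono a_ex_lipschitz)
  finally show ?thesis by (simp add: sum_distrib_left)
qed

lemma f_ex_lipschitz_snd: "\<bar>f_ex (p, z) - f_ex (p, z')\<bar> \<le> 12 * norm (z - z')"
proof -
  have "\<bar>f_ex (p, z) - f_ex (p, z')\<bar> = \<bar>\<Sum>i\<in>UNIV. a_ex i p * (\<bar>z $ i\<bar> - \<bar>z' $ i\<bar>)\<bar>"
    by (simp add: f_ex_def sum_subtractf right_diff_distrib)
  \<comment> \<open>Four coordinates with weights at most 3 give the constant 12.\<close>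
  also have "\<dots> \<le> (\<Sum>i\<in>(UNIV :: 4 set). 3 * norm (z - z'))"
  proof (rule order_trans[OF sum_abs], rule sum_mono)
    fix i :: 4
    have "\<bar>\<bar>z $ i\<bar> - \<bar>z' $ i\<bar>\<bar> \<le> norm (z - z')"
      using component_le_norm_cart[of "z - z'" i] by simp
    moreover have "\<bar>a_ex i p\<bar> \<le> 3" using a_ex_bounds[of i p] by simp
    ultimately show "\<bar>a_ex i p * (\<bar>z $ i\<bar> - \<bar>z' $ i\<bar>)\<bar> \<le> 3 * norm (z - z')"
      unfolding abs_mult by (intro mult_mono) auto
  qed
  finally show ?thesis by simp
qed

lemma sum_abs_nth_le: "(\<Sum>i\<in>UNIV. \<bar>z $ i\<bar>) \<le> real CARD('n) * norm (z :: real^'n)"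
  using sum_bounded_above[of UNIV "\<lambda>i. \<bar>z $ i\<bar>" "norm z"] component_le_norm_cart by auto

lemma f_ex_locally_lipschitz: "locally_lipschitz f_ex"
  unfolding locally_lipschitz_def
proof
  fix x :: "(real^2) \<times> (real^4)"
  \<comment> \<open>On the unit ball around \<open>x\<close> the \<open>z\<close>-part has norm at
    most \<open>norm (snd x) + 1\<close>. The factor 8 is 2 (Lipschitz constant of the weights)
    times 4 (sum of absolute values against the norm); 12 comes from moving
    \<open>z\<close>.\<close>
  let ?L = "8 * (norm (snd x) + 1) + 12"
  have "?L-lipschitz_on (ball x 1) f_ex"
  proof (rule lipschitz_onI)
    fix u w assume u: "u \<in> ball x 1" and w: "w \<in> ball x 1"
    obtain p z p' z' where uw: "u = (p, z)" "w = (p', z')" by (cases u, cases w) blast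
    have "norm (snd (u - x)) \<le> norm (u - x)"
      by (metis norm_snd_le prod.collapse)
    then have "norm z \<le> norm (snd x) + 1"
      using u uw norm_triangle_ineq2[of z "snd x"] by (simp add: dist_norm norm_minus_commute)
    then have z: "(\<Sum>i\<in>UNIV. \<bar>z $ i\<bar>) \<le> 4 * (norm (snd x) + 1)"
      using sum_abs_nth_le[of z] by simp
    have d: "norm (p - p') \<le> dist u w" "norm (z - z') \<le> dist u w"
      using norm_fst_le[of "p - p'" "z - z'"] norm_snd_le[of "z - z'" "p - p'"]
      by (simp_all add: uw dist_norm)
    have "\<bar>f_ex u - f_ex w\<bar> \<le> \<bar>f_ex (p, z) - f_ex (p', z)\<bar> + \<bar>f_ex (p', z) - f_ex (p', z')\<bar>"
      by (simp add: uw)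
    also have "\<dots> \<le> 2 * norm (p - p') * (\<Sum>i\<in>UNIV. \<bar>z $ i\<bar>) + 12 * norm (z - z')"
      by (intro add_mono f_ex_lipschitz_fst f_ex_lipschitz_snd)
    also have "\<dots> \<le> 2 * dist u w * (4 * (norm (snd x) + 1)) + 12 * dist u w"
      by (intro add_mono mult_mono d z) (auto intro: sum_nonneg)
    finally show "dist (f_ex u) (f_ex w) \<le> ?L * dist u w"
      by (simp add: dist_real_def algebra_simps)
  qed simp
  then show "\<exists>e>0. \<exists>L. L-lipschitz_on (ball x e) f_ex"
    using zero_less_one by blast
qed

section \<open>Clarke subgradients of f\<close>

lemma f_ex_clarke_norm_ge:
  assumes v: "v \<in> clarke_subdiff f_ex x" and x: "x \<notin> UNIV \<times> {0}"
  shows "norm v \<ge> 1"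
proof -
  obtain p z where pz: "x = (p, z)" by fastforce
  then obtain i where i: "z $ i \<noteq> 0" using x by (auto simp: vec_eq_iff)
  let ?s = "sgn (z $ i)"
  \<comment> \<open>Unit direction moving the nonzero coordinate \<open>z $ i\<close> towards
    0.\<close>
  let ?d = "(0 :: real^2, - ?s *\<^sub>R axis i 1 :: real^4)"
  \<comment> \<open>Base points near \<open>x\<close> keep the signed coordinate above half of
    \<open>\<bar>z $ i\<bar>\<close>, and \<open>t\<close> is taken below that half, so the step
    never crosses the kink at 0.\<close>
  have "((\<lambda>y. snd y $ i * ?s) \<longlongrightarrow> snd x $ i * ?s) (nhds x)"
    by (intro tendsto_intros filterlim_ident)
  moreover have "snd x $ i * ?s > \<bar>z $ i\<bar> / 2"
    using i by (simp add: pz abs_sgn[symmetric])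
  ultimately have 1: "\<forall>\<^sub>F y in nhds x. snd y $ i * ?s > \<bar>z $ i\<bar> / 2"
    by (rule order_tendstoD)
  have 2: "\<forall>\<^sub>F t in at_right 0. t \<in> {0<..<\<bar>z $ i\<bar> / 2}"
    using i by (intro eventually_at_right_real) simp
  have ev: "\<forall>\<^sub>F (y, t) in nhds x \<times>\<^sub>F at_right 0. (f_ex (y + t *\<^sub>R ?d) - f_ex y) / t \<le> - 1"
    using eventually_prodI[OF 1 2]
  proof eventually_elim
    case (elim yt)
    obtain p' z' t where yt: "yt = ((p', z'), t)" by (metis surj_pair)
    have t: "t > 0" "t < z' $ i * ?s" using elim by (auto simp: yt)
    have i': "\<bar>z' $ i - t * ?s\<bar> = \<bar>z' $ i\<bar> - t"
      using t i by (cases "z $ i > 0") auto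
    have "f_ex ((p', z') + t *\<^sub>R ?d) - f_ex (p', z')
        = (\<Sum>j\<in>UNIV. a_ex j p' * (\<bar>(z' - (t * ?s) *\<^sub>R axis i 1) $ j\<bar> - \<bar>z' $ j\<bar>))"
      by (simp add: f_ex_def sum_subtractf right_diff_distrib)
    \<comment> \<open>Only the summand \<open>i\<close> changes, and it drops by exactly
      \<open>t\<close> times its weight.\<close>
    also have "\<dots> = (\<Sum>j\<in>UNIV. if j = i then - (a_ex i p' * t) else 0)"
      by (intro sum.cong) (auto simp: i' axis_def right_diff_distrib)
    also have "\<dots> \<le> - t"
      using a_ex_bounds(1)[of i p'] t by simp
    finally show ?case using t by (simp add: yt divide_le_eq)
  qed
  have "v \<bullet> ?d \<le> - 1" by (rule clarke_subdiff_inner_le[OF v ev]) simp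
  moreover have "\<bar>v \<bullet> ?d\<bar> \<le> norm v * norm ?d" by (rule Cauchy_Schwarz_ineq2)
  moreover have "norm ?d = 1" using i by (simp add: norm_prod_def norm_axis_1 abs_sgn_eq)
  ultimately show ?thesis by simp
qed

text \<open>Testing \<open>v\<close> in the direction of its own first component yields the squared
  norm of \<open>fst v\<close> on the left and one factor \<open>norm (fst v)\<close> on the right,
  to be cancelled.\<close>

lemma f_ex_clarke_fst_le:
  assumes v: "v \<in> clarke_subdiff f_ex x"
  shows "norm (fst v) \<le> 8 * norm (snd x)"
proof -
  let ?d = "(fst v, 0 :: real^4)"
  let ?g = "\<lambda>y :: (real^2) \<times> (real^4). 2 * norm (fst v) * (\<Sum>i\<in>UNIV. \<bar>snd y $ i\<bar>)"
  have "\<forall>\<^sub>F t :: real in at_right 0. t > 0" by (rule eventually_at_right_less)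
  then have "\<forall>\<^sub>F yt in nhds x \<times>\<^sub>F at_right 0. True \<and> snd yt > (0::real)"
    by (intro eventually_prodI) auto
  then have "\<forall>\<^sub>F (y, t) in nhds x \<times>\<^sub>F at_right 0. (f_ex (y + t *\<^sub>R ?d) - f_ex y) / t \<le> ?g y"
  proof eventually_elim
    case (elim yt)
    obtain p' z' t where yt: "yt = ((p', z'), t)" by (metis surj_pair)
    then show ?case
      using elim f_ex_lipschitz_fst[of "p' + t *\<^sub>R fst v" z' p']
      by (simp add: divide_le_eq algebra_simps abs_le_iff)
  qed
  moreover have "isCont ?g x" by (intro continuous_intros)
  ultimately have "v \<bullet> ?d \<le> ?g x" by (rule clarke_subdiff_inner_le[OF v])
  also have "\<dots> \<le> 2 * norm (fst v) * (4 * norm (snd x))"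
    using sum_abs_nth_le[of "snd x"] by (intro mult_left_mono) auto
  finally have "norm (fst v) * norm (fst v) \<le> norm (fst v) * (8 * norm (snd x))"
    by (simp add: inner_prod_def dot_square_norm power2_eq_square)
  then show ?thesis
    by (cases "fst v = 0") (auto dest: mult_left_le_imp_le)
qed

theorem proposition4p3:
  fixes S :: "nat \<Rightarrow> real list set set" and pstar :: "real^2"
  assumes "poly_bounded_ominimal S"
    and "norm pstar > 1/2"
  shows "active_geometry S f_ex (UNIV \<times> {0}) (pstar, 0)"
proof -
  interpret poly_bounded_ominimal S by fact
  let ?A = "UNIV \<times> {0} :: ((real^2) \<times> (real^4)) set"
  have A: "subspace ?A" by (auto simp: subspace_def zero_prod_def)
  \<comment> \<open>The zero remainder suffices: f is nonnegative and vanishes at the base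
    point.\<close>
  have frechet: "0 \<in> frechet_subdiff f_ex (pstar, 0)"
    unfolding frechet_subdiff_def
    by (auto intro!: bexI[of _ "\<lambda>_. 0"] simp: f_ex_zero f_ex_nonneg)
  have definable: "definable_in S ?A"
    unfolding UNIV_times_zero_eq by (rule definable_in_coordinate_subspace)
  have C2: "Ck_restriction_on 2 ?A UNIV f_ex"
    unfolding Ck_restriction_on_def
    by (intro ballI exI[of _ UNIV] exI[of _ "\<lambda>_. 0"]) (auto simp: Ck_on_const f_ex_zero)
  have verdier: "norm (orth_proj (tangent_space ?A y) v - riemannian_grad ?A f_ex y)
      \<le> 8 * norm (x - y)" if y: "y \<in> ?A" and v: "v \<in> clarke_subdiff f_ex x" for x y v
  proof -
    have "orth_proj ?A v = (fst v, 0)"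
      by (rule orth_proj_eqI[OF A]) (auto simp: orthogonal_def inner_prod_def)
    then have "norm (orth_proj (tangent_space ?A y) v - riemannian_grad ?A f_ex y) = norm (fst v)"
      by (simp add: tangent_space_subspace[OF A y] riemannian_grad_eq_zero[OF A y f_ex_zero])
    also have "\<dots> \<le> 8 * norm (snd x)" using v by (rule f_ex_clarke_fst_le)
    \<comment> \<open>Since \<open>snd y = 0\<close>, the distance of \<open>x\<close> to the
      manifold is controlled by its distance to \<open>y\<close>.\<close>
    also have "snd x = snd (x - y)" using y by auto
    also have "norm \<dots> \<le> norm (x - y)" by (metis norm_snd_le prod.collapse)
    finally show ?thesis by simp
  qed
  have "\<exists>U0 \<sigma> C. open U0 \<and> (pstar, 0) \<in> U0 \<and> \<sigma> > 0 \<and> C > 0 \<and>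
      Ck_restriction_on 2 ?A U0 f_ex \<and>
      (\<forall>z\<in>U0 - ?A. \<forall>v\<in>clarke_subdiff f_ex z. norm v \<ge> \<sigma>) \<and>
      (\<forall>z\<in>U0. \<forall>y\<in>?A \<inter> U0. \<forall>v\<in>clarke_subdiff f_ex z.
        norm (orth_proj (tangent_space ?A y) v - riemannian_grad ?A f_ex y) \<le> C * norm (z - y))"
    \<comment> \<open>The estimates are global: the neighborhood is the whole space, with activity
      constant 1 and Verdier constant 8.\<close>
    by (rule exI[of _ UNIV], rule exI[of _ 1], rule exI[of _ 8])
      (use C2 f_ex_clarke_norm_ge verdier in auto)
  then show ?thesis
    unfolding active_geometry_def
    using f_ex_locally_lipschitz frechet definable embedded_manifold_subspace[OF A] by auto
qed

end
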